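(* Let $(\Omega,\mathcal{F})$ be a measurable space, let $\mu$ be a finitely-additive positive measure on $(\Omega,\mathcal{F})$ and let $\mathcal{G}\subseteq\mathcal{F}$. Then: 1. The following two statements are equivalent: (a) There exists a set $G_\mu\in\mathcal{G}$ such that $G\setminus G_\mu$ is a $\mu$-null set for every $G\in\mathcal{G}$. (b) There exist a set $\bar{G}\in\mathcal{G}$ and two finitely-additive positive measures $\mu_{\mathcal{G}},\mu_{\mathcal{G}}^\perp$ on $(\Omega,\mathcal{F})$ such that $\mu=\mu_{\mathcal{G}}+\mu_{\mathcal{G}}^\perp$, $\mu_{\mathcal{G}}$ is concentrated on $\bar{G}$, and every $G\in\mathcal{G}$ is $\mu_{\mathcal{G}}^\perp$-null. Moreover, if the equivalent statements (a) and (b) hold then, for any $G_\mu$ as in (a) and any $\bar{G},\mu_{\mathcal{G}},\mu_{\mathcal{G}}^\perp$ as in (b), $G_\mu$ and $\bar{G}$ are unique up to a $\mu$-null set, $G_\mu=\bar{G}$ up to a $\mu$-null set, $\mu_{\mathcal{G}}=\mu(G_\mu\cap\cdot)$ and $\mu_{\mathcal{G}}^\perp=\mu(G_\mu^c\cap\cdot)$; in particular, such $\mu_{\mathcal{G}},\mu_{\mathcal{G}}^\perp$ are unique. 2. If $\mu$ is $\sigma$-finite and countably-additive, and $\mathcal{G}$ is non-empty and closed under countable unions, then there exists a set $G_\mu\in\mathcal{G}$ such that $G\setminus G_\mu$ is a $\mu$-null set for every $G\in\mathcal{G}$.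
   Context: $\mathcal{F}$ is a $\sigma$-algebra on $\Omega$, and $A^c:=\Omega\setminus A$. Positive measures (finitely or countably additive) take values in $[0,\infty]$ and vanish on $\emptyset$. For a (finitely or countably additive) measure $\lambda$ on $(\Omega,\mathcal{F})$, a set $F\in\mathcal{F}$ is $\lambda$-null if $\lambda(H)=0$ for all $H\in\mathcal{F}$ with $H\subseteq F$ (for a positive measure this is equivalent to $\lambda(F)=0$). $\lambda$ is concentrated on $F\in\mathcal{F}$ if $F^c$ is $\lambda$-null. Two sets $F,F'\in\mathcal{F}$ are equal up to a $\lambda$-null set if $F\setminus F'$ and $F'\setminus F$ are $\lambda$-null. *)

theory Defs
  imports "HOL-Analysis.Analysis"
begin

text \<open>
  Finitely additive positive measures are set functions \<open>'a set \<Rightarrow> ennreal\<close>, of which only the values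
  on the \<open>\<sigma>\<close>-algebra matter; two of them are the same measure iff they agree on the
  \<open>\<sigma>\<close>-algebra. Nonnegativity is built into \<^typ>\<open>ennreal\<close>, so \<^const>\<open>positive\<close> only says that the
  empty set has measure \<open>0\<close>.
\<close>

definition fa_measure :: "'a set set \<Rightarrow> ('a set \<Rightarrow> ennreal) \<Rightarrow> bool" where
  "fa_measure \<F> \<mu> \<longleftrightarrow> positive \<F> \<mu> \<and> additive \<F> \<mu>"

text \<open>
  The library's \<^const>\<open>null_sets\<close> is only available for countably additive measures.
\<close>

definition is_null :: "'a set set \<Rightarrow> ('a set \<Rightarrow> 'b::zero) \<Rightarrow> 'a set \<Rightarrow> bool" where
  "is_null \<F> \<nu> A \<longleftrightarrow> A \<in> \<F> \<and> (\<forall>H\<in>\<F>. H \<subseteq> A \<longrightarrow> \<nu> H = 0)"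

definition concentrated_on ::
    "'a set \<Rightarrow> 'a set set \<Rightarrow> ('a set \<Rightarrow> 'b::zero) \<Rightarrow> 'a set \<Rightarrow> bool" where
  "concentrated_on \<Omega> \<F> \<nu> A \<longleftrightarrow> A \<in> \<F> \<and> is_null \<F> \<nu> (\<Omega> - A)"

definition eq_upto_null ::
    "'a set set \<Rightarrow> ('a set \<Rightarrow> 'b::zero) \<Rightarrow> 'a set \<Rightarrow> 'a set \<Rightarrow> bool" where
  "eq_upto_null \<F> \<nu> A B \<longleftrightarrow>
     A \<in> \<F> \<and> B \<in> \<F> \<and> is_null \<F> \<nu> (A - B) \<and> is_null \<F> \<nu> (B - A)"

definition ess_greatest ::
    "'a set set \<Rightarrow> ('a set \<Rightarrow> ennreal) \<Rightarrow> 'a set set \<Rightarrow> 'a set \<Rightarrow> bool" where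
  "ess_greatest \<F> \<mu> \<G> X \<longleftrightarrow> X \<in> \<G> \<and> (\<forall>G\<in>\<G>. is_null \<F> \<mu> (G - X))"

definition class_decomposition ::
    "'a set \<Rightarrow> 'a set set \<Rightarrow> ('a set \<Rightarrow> ennreal) \<Rightarrow> 'a set set \<Rightarrow>
     'a set \<Rightarrow> ('a set \<Rightarrow> ennreal) \<Rightarrow> ('a set \<Rightarrow> ennreal) \<Rightarrow> bool" where
  "class_decomposition \<Omega> \<F> \<mu> \<G> Y \<mu>1 \<mu>2 \<longleftrightarrow>
     Y \<in> \<G> \<and> fa_measure \<F> \<mu>1 \<and> fa_measure \<F> \<mu>2 \<and>
     (\<forall>A\<in>\<F>. \<mu> A = \<mu>1 A + \<mu>2 A) \<and>
     concentrated_on \<Omega> \<F> \<mu>1 Y \<and> (\<forall>G\<in>\<G>. is_null \<F> \<mu>2 G)"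

text \<open>
  For countably additive \<open>\<mu>\<close>, the measure \<^term>\<open>measure_of \<Omega> \<F> \<mu>\<close> has space \<open>\<Omega>\<close>, \<open>\<sigma>\<close>-algebra \<open>\<F>\<close>
  and agrees with \<open>\<mu>\<close> on \<open>\<F>\<close>. Otherwise \<^const>\<open>measure_of\<close> yields the zero measure, so countable
  additivity has to be part of this definition.
\<close>

definition sigma_finite_ca_measure ::
    "'a set \<Rightarrow> 'a set set \<Rightarrow> ('a set \<Rightarrow> ennreal) \<Rightarrow> bool" where
  "sigma_finite_ca_measure \<Omega> \<F> \<mu> \<longleftrightarrow>
     measure_space \<Omega> \<F> \<mu> \<and> sigma_finite_measure (measure_of \<Omega> \<F> \<mu>)"

end

theory Submission
  imports Defs
begin

text \<open>
  Every decomposition as in (b) is the restriction of \<open>\<mu>\<close> to \<open>Y\<close> and to its complement: below \<open>Y\<close>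
  the second part vanishes, and off \<open>Y\<close> the first one does. Changing \<open>Y\<close> by a null set does not
  change these restrictions, whence all uniqueness claims. For the existence claim, \<open>\<mu>\<close> is replaced
  by a finite measure with the same null sets; the union of a sequence in \<open>\<G>\<close> whose measures
  approach the supremum over \<open>\<G>\<close> attains this supremum, so no member of \<open>\<G>\<close> can exceed it by a
  set of positive measure.
\<close>

lemma is_null_iff_additive:
  assumes "sigma_algebra \<Omega> \<F>" "fa_measure \<F> \<mu>"
  shows "is_null \<F> \<mu> A \<longleftrightarrow> A \<in> \<F> \<and> \<mu> A = 0"
proof -
  interpret sigma_algebra \<Omega> \<F> by fact
  have "\<mu> H \<le> \<mu> A" if "A \<in> \<F>" "H \<in> \<F>" "H \<subseteq> A" for H
    using additive_increasing[of \<mu>] assms(2) that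
    unfolding fa_measure_def increasing_def by blast
  then show ?thesis unfolding is_null_def by fastforce
qed

lemma fa_measure_split:
  assumes "sigma_algebra \<Omega> \<F>" "fa_measure \<F> \<mu>" "A \<in> \<F>" "B \<in> \<F>"
  shows "\<mu> A = \<mu> (B \<inter> A) + \<mu> (A - B)"
proof -
  interpret sigma_algebra \<Omega> \<F> by fact
  have "\<mu> ((B \<inter> A) \<union> (A - B)) = \<mu> (B \<inter> A) + \<mu> (A - B)"
    using assms by (intro additiveD[of \<F>]) (auto simp: fa_measure_def)
  moreover have "(B \<inter> A) \<union> (A - B) = A" by blast
  ultimately show ?thesis by simp
qed

text \<open>Both sides equal \<open>\<mu> (A \<inter> B)\<close>. Nothing is subtracted, so infinite
  values do no harm.\<close>

lemma fa_measure_cong_null: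
  assumes sa: "sigma_algebra \<Omega> \<F>" and fa: "fa_measure \<F> \<mu>" and A: "A \<in> \<F>" and B: "B \<in> \<F>"
    and "is_null \<F> \<mu> (A - B)" "is_null \<F> \<mu> (B - A)"
  shows "\<mu> A = \<mu> B"
  using fa_measure_split[OF sa fa A B] fa_measure_split[OF sa fa B A] assms(5,6)
  by (simp add: is_null_iff_additive[OF sa fa] Int_commute)

lemma is_null_subset:
  assumes "is_null \<F> \<mu> A" "B \<in> \<F>" "B \<subseteq> A"
  shows "is_null \<F> \<mu> B"
  using assms unfolding is_null_def by blast

lemma fa_measure_restrict:
  assumes "sigma_algebra \<Omega> \<F>" "fa_measure \<F> \<mu>" "X \<in> \<F>"
  shows "fa_measure \<F> (\<lambda>A. \<mu> (X \<inter> A))"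
proof -
  interpret sigma_algebra \<Omega> \<F> by fact
  have "\<mu> (X \<inter> (A \<union> B)) = \<mu> (X \<inter> A) + \<mu> (X \<inter> B)"
    if "A \<in> \<F>" "B \<in> \<F>" "A \<inter> B = {}" for A B
    unfolding Int_Un_distrib
    using assms that by (intro additiveD[of \<F>]) (auto simp: fa_measure_def)
  then show ?thesis
    using assms(2) by (auto simp: fa_measure_def positive_def additive_def)
qed

text \<open>Each of the two sets is itself a member of \<open>\<G>\<close> and hence is covered, up
  to a null set, by the other.\<close>

lemma ess_greatest_unique:
  assumes "\<G> \<subseteq> \<F>" "ess_greatest \<F> \<mu> \<G> X" "ess_greatest \<F> \<mu> \<G> Y"
  shows "eq_upto_null \<F> \<mu> X Y"
  using assms unfolding ess_greatest_def eq_upto_null_def by blast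

lemma eq_upto_null_restrict:
  assumes sa: "sigma_algebra \<Omega> \<F>" and fa: "fa_measure \<F> \<mu>"
    and eq: "eq_upto_null \<F> \<mu> X Y" and A: "A \<in> \<F>"
  shows "\<mu> (X \<inter> A) = \<mu> (Y \<inter> A)" "\<mu> ((\<Omega> - X) \<inter> A) = \<mu> ((\<Omega> - Y) \<inter> A)"
proof -
  interpret sigma_algebra \<Omega> \<F> by fact
  have XY: "X \<in> \<F>" "Y \<in> \<F>" and n: "is_null \<F> \<mu> (X - Y)" "is_null \<F> \<mu> (Y - X)"
    using eq by (auto simp: eq_upto_null_def)
  have "is_null \<F> \<mu> (X \<inter> A - Y \<inter> A)" "is_null \<F> \<mu> (Y \<inter> A - X \<inter> A)"
    using XY A by (auto intro: is_null_subset[OF n(1)] is_null_subset[OF n(2)])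
  then show "\<mu> (X \<inter> A) = \<mu> (Y \<inter> A)"
    using XY A by (intro fa_measure_cong_null[OF sa fa]) auto
  have "(\<Omega> - X) \<inter> A - (\<Omega> - Y) \<inter> A \<in> \<F>" "(\<Omega> - Y) \<inter> A - (\<Omega> - X) \<inter> A \<in> \<F>"
    using XY A by auto
  \<comment> \<open>Complements reverse differences: the first set lies in \<open>Y - X\<close> and
    the second in \<open>X - Y\<close>.\<close>
  then have "is_null \<F> \<mu> ((\<Omega> - X) \<inter> A - (\<Omega> - Y) \<inter> A)" "is_null \<F> \<mu> ((\<Omega> - Y) \<inter> A - (\<Omega> - X) \<inter> A)"
    by (auto intro: is_null_subset[OF n(2)] is_null_subset[OF n(1)])
  then show "\<mu> ((\<Omega> - X) \<inter> A) = \<mu> ((\<Omega> - Y) \<inter> A)"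
    using XY A by (intro fa_measure_cong_null[OF sa fa]) auto
qed

text \<open>This gives (b) from (a), with the set of (a) as the set of (b). The second part is null
  on each \<open>G\<close> because removing \<open>X\<close> from a subset of \<open>G\<close>
  leaves a subset of the null set \<open>G - X\<close>.\<close>

lemma ess_greatest_imp_class_decomposition:
  assumes sa: "sigma_algebra \<Omega> \<F>" and fa: "fa_measure \<F> \<mu>" and sub: "\<G> \<subseteq> \<F>"
    and X: "ess_greatest \<F> \<mu> \<G> X"
  shows "class_decomposition \<Omega> \<F> \<mu> \<G> X (\<lambda>A. \<mu> (X \<inter> A)) (\<lambda>A. \<mu> ((\<Omega> - X) \<inter> A))"
proof -
  interpret sigma_algebra \<Omega> \<F> by fact
  have XG: "X \<in> \<G>" and XF: "X \<in> \<F>" using X sub by (auto simp: ess_greatest_def)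
  have zero: "\<mu> {} = 0" using fa by (simp add: fa_measure_def positive_def)
  have "\<mu> A = \<mu> (X \<inter> A) + \<mu> ((\<Omega> - X) \<inter> A)" if "A \<in> \<F>" for A
  proof -
    have "(\<Omega> - X) \<inter> A = A - X" using sets_into_space[OF that] by blast
    then show ?thesis using fa_measure_split[OF sa fa that XF] by simp
  qed
  moreover have "concentrated_on \<Omega> \<F> (\<lambda>A. \<mu> (X \<inter> A)) X"
  proof -
    have "X \<inter> H = {}" if "H \<subseteq> \<Omega> - X" for H using that by blast
    then show ?thesis using XF zero by (auto simp: concentrated_on_def is_null_def)
  qed
  moreover have "is_null \<F> (\<lambda>A. \<mu> ((\<Omega> - X) \<inter> A)) G" if G: "G \<in> \<G>" for G
  proof -
    have "is_null \<F> \<mu> (G - X)" using X G by (simp add: ess_greatest_def)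
    moreover have "(\<Omega> - X) \<inter> H \<in> \<F>" "(\<Omega> - X) \<inter> H \<subseteq> G - X" if "H \<in> \<F>" "H \<subseteq> G" for H
      using that XF by auto
    ultimately have "\<mu> ((\<Omega> - X) \<inter> H) = 0" if "H \<in> \<F>" "H \<subseteq> G" for H
      using that by (simp add: is_null_def)
    then show ?thesis using G sub by (auto simp: is_null_def)
  qed
  ultimately show ?thesis
    using XG XF fa_measure_restrict[OF sa fa] by (simp add: class_decomposition_def compl_sets)
qed

text \<open>A measurable subset of \<open>G - Y\<close> lies off \<open>Y\<close>, where
  \<open>\<mu>1\<close> vanishes, and inside \<open>G\<close>, where \<open>\<mu>2\<close>
  vanishes.\<close>

lemma class_decomposition_imp_ess_greatest:
  assumes sa: "sigma_algebra \<Omega> \<F>" and sub: "\<G> \<subseteq> \<F>"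
    and dec: "class_decomposition \<Omega> \<F> \<mu> \<G> Y \<mu>1 \<mu>2"
  shows "ess_greatest \<F> \<mu> \<G> Y"
proof -
  interpret sigma_algebra \<Omega> \<F> by fact
  have "is_null \<F> \<mu> (G - Y)" if G: "G \<in> \<G>" for G
    unfolding is_null_def
  proof (intro conjI ballI impI)
    show "G - Y \<in> \<F>" using G sub dec by (auto simp: class_decomposition_def)
    fix H assume H: "H \<in> \<F>" "H \<subseteq> G - Y"
    have "H \<subseteq> \<Omega> - Y" "H \<subseteq> G" using H sets_into_space by auto
    then have "\<mu>1 H = 0" "\<mu>2 H = 0"
      using H(1) G dec by (auto simp: class_decomposition_def concentrated_on_def is_null_def)
    then show "\<mu> H = 0" using H(1) dec by (simp add: class_decomposition_def)
  qed
  then show ?thesis using dec by (simp add: ess_greatest_def class_decomposition_def)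
qed

lemma class_decomposition_parts:
  assumes sa: "sigma_algebra \<Omega> \<F>" and sub: "\<G> \<subseteq> \<F>"
    and dec: "class_decomposition \<Omega> \<F> \<mu> \<G> Y \<mu>1 \<mu>2" and A: "A \<in> \<F>"
  shows "\<mu>1 A = \<mu> (Y \<inter> A)" "\<mu>2 A = \<mu> ((\<Omega> - Y) \<inter> A)"
proof -
  interpret sigma_algebra \<Omega> \<F> by fact
  have Y: "Y \<in> \<F>" and fa: "fa_measure \<F> \<mu>1" "fa_measure \<F> \<mu>2"
    and sum: "\<And>B. B \<in> \<F> \<Longrightarrow> \<mu> B = \<mu>1 B + \<mu>2 B"
    and n: "is_null \<F> \<mu>1 (\<Omega> - Y)" "is_null \<F> \<mu>2 Y"
    using dec sub by (auto simp: class_decomposition_def concentrated_on_def)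
  have [simp]: "(\<Omega> - Y) \<inter> A = A - Y" using sets_into_space[OF A] by blast
  have m: "A - Y \<in> \<F>" "Y \<inter> A \<in> \<F>" using A Y by auto
  \<comment> \<open>The second equation rests on \<open>Y\<close> being a member of
    \<open>\<G>\<close>, so that \<open>Y\<close> is null for \<open>\<mu>2\<close>. Hence
    \<open>\<mu>\<close> equals \<open>\<mu>1\<close> on \<open>Y \<inter> A\<close> and
    \<open>\<mu>2\<close> on \<open>A - Y\<close>.\<close>
  have "\<mu>1 (A - Y) = 0" "\<mu>2 (Y \<inter> A) = 0"
    using n m sets_into_space[OF A] by (auto simp: is_null_def)
  then show "\<mu>1 A = \<mu> (Y \<inter> A)" "\<mu>2 A = \<mu> ((\<Omega> - Y) \<inter> A)"
    using fa_measure_split[OF sa fa(1) A Y] fa_measure_split[OF sa fa(2) A Y] sum m by simp_all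
qed

lemma (in finite_measure) ex_ess_greatest:
  assumes sub: "\<G> \<subseteq> sets M" and ne: "\<G> \<noteq> {}"
    and UN: "\<And>A :: nat \<Rightarrow> 'a set. range A \<subseteq> \<G> \<Longrightarrow> (\<Union>n. A n) \<in> \<G>"
  shows "\<exists>X\<in>\<G>. \<forall>G\<in>\<G>. G - X \<in> null_sets M"
proof -
  \<comment> \<open>The supremum over the non-empty class is already the supremum of countably many
    of its values.\<close>
  obtain f :: "nat \<Rightarrow> ennreal" where f: "range f \<subseteq> emeasure M ` \<G>" "(SUP G\<in>\<G>. emeasure M G) = Sup (range f)"
    using ennreal_Sup_countable_SUP[of "emeasure M ` \<G>"] ne by auto
  have "\<forall>n. \<exists>G\<in>\<G>. f n = emeasure M G" using f(1) by blast
  then obtain A where A: "\<And>n. A n \<in> \<G>" "\<And>n. f n = emeasure M (A n)" by metis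
  define X where "X = (\<Union>n. A n)"
  have X: "X \<in> \<G>" unfolding X_def using A by (intro UN) auto
  have "Sup (range f) \<le> emeasure M X"
    unfolding A(2) using A(1) X sub by (intro SUP_least emeasure_mono) (auto simp: X_def)
  then have max: "emeasure M G \<le> emeasure M X" if "G \<in> \<G>" for G
    using f(2) SUP_upper[of G \<G> "emeasure M"] that by simp
  have "G - X \<in> null_sets M" if G: "G \<in> \<G>" for G
  proof -
    \<comment> \<open>Closure is assumed for unions of sequences, so the binary union is written as
      that of \<open>X, G, G, ...\<close>.\<close>
    have "(\<Union>n::nat. if n = 0 then X else G) = X \<union> G" by (auto split: if_splits)
    then have "X \<union> G \<in> \<G>" using UN[of "\<lambda>n. if n = 0 then X else G"] X G by (simp add: image_subset_iff)
    then have "emeasure M (X \<union> (G - X)) \<le> emeasure M X" using max by simp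
    moreover have "emeasure M (X \<union> (G - X)) = emeasure M X + emeasure M (G - X)"
      using X G sub by (intro plus_emeasure[symmetric]) auto
    \<comment> \<open>Finiteness enters here: the measure of \<open>X\<close> can be
      cancelled.\<close>
    ultimately have "emeasure M (G - X) = 0"
      using emeasure_finite[of X] by (cases "emeasure M X"; cases "emeasure M (G - X)")
        (auto simp flip: ennreal_plus simp: top_unique)
    then show ?thesis using X G sub by auto
  qed
  then show ?thesis using X by blast
qed

text \<open>A strictly positive integrable density turns \<open>M\<close> into a finite measure on
  the same \<sigma>-algebra, to which the finite case applies. To come back, it is enough that its
  null sets are null for \<open>M\<close>.\<close>

lemma (in sigma_finite_measure) ex_ess_greatest:
  assumes sub: "\<G> \<subseteq> sets M" and ne: "\<G> \<noteq> {}"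
    and UN: "\<And>A :: nat \<Rightarrow> 'a set. range A \<subseteq> \<G> \<Longrightarrow> (\<Union>n. A n) \<in> \<G>"
  shows "\<exists>X\<in>\<G>. \<forall>G\<in>\<G>. G - X \<in> null_sets M"
proof -
  obtain h where h: "h \<in> borel_measurable M" "integral\<^sup>N M h \<noteq> \<infinity>"
      "\<And>x. x \<in> space M \<Longrightarrow> 0 < h x \<and> h x < \<infinity>"
    using Ex_finite_integrable_function by blast
  interpret D: finite_measure "density M h"
    using h(1,2) by (intro finite_measureI) (simp add: emeasure_density cong: nn_integral_cong)
  have "A \<in> null_sets M" if "A \<in> null_sets (density M h)" for A
  proof -
    have A: "A \<in> sets M" and "AE x in M. x \<in> A \<longrightarrow> h x = 0"
      using that h(1) by (auto simp: null_sets_density_iff)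
    \<comment> \<open>The density vanishes almost everywhere on \<open>A\<close> but is positive on
      the whole space.\<close>
    then have "AE x in M. x \<notin> A"
      using h(3) by (auto elim!: eventually_rev_mp intro!: AE_I2 simp: order_less_le)
    then show ?thesis using A by (simp add: AE_iff_null_sets)
  qed
  moreover have "\<exists>X\<in>\<G>. \<forall>G\<in>\<G>. G - X \<in> null_sets (density M h)"
    using sub by (intro D.ex_ess_greatest ne UN) simp_all
  ultimately show ?thesis by blast
qed

text \<open>The result for measures is carried over to the set function \<open>\<mu>\<close>:
  countable additivity makes \<open>measure_of\<close> agree with it on \<open>\<F>\<close>, and it
  implies finite additivity, so null sets can be recognised by their value alone.\<close>

lemma sigma_finite_ca_ess_greatest:
  assumes sf: "sigma_finite_ca_measure \<Omega> \<F> \<mu>" and sub: "\<G> \<subseteq> \<F>" and ne: "\<G> \<noteq> {}"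
    and UN: "\<And>A :: nat \<Rightarrow> 'a set. range A \<subseteq> \<G> \<Longrightarrow> (\<Union>n. A n) \<in> \<G>"
  shows "\<exists>X. ess_greatest \<F> \<mu> \<G> X"
proof -
  have ms: "measure_space \<Omega> \<F> \<mu>" using sf by (simp add: sigma_finite_ca_measure_def)
  interpret sigma_algebra \<Omega> \<F> using ms by (simp add: measure_space_def)
  interpret M: sigma_finite_measure "measure_of \<Omega> \<F> \<mu>"
    using sf by (simp add: sigma_finite_ca_measure_def)
  have sets: "sets (measure_of \<Omega> \<F> \<mu>) = \<F>" by simp
  have em: "emeasure (measure_of \<Omega> \<F> \<mu>) A = \<mu> A" if "A \<in> \<F>" for A
    using ms that by (intro emeasure_measure_of_sigma) (auto simp: measure_space_def)
  have fa: "fa_measure \<F> \<mu>"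
    using ms countably_additive_additive by (auto simp: fa_measure_def measure_space_def)
  have "A \<in> \<F> \<and> \<mu> A = 0" if "A \<in> null_sets (measure_of \<Omega> \<F> \<mu>)" for A
    using that em sets by (auto simp: null_sets_def)
  then show ?thesis
    using M.ex_ess_greatest[of \<G>] sets sub ne UN
    unfolding ess_greatest_def is_null_iff_additive[OF sigma_algebra_axioms fa] by metis
qed

theorem theorem2p3:
  fixes \<Omega> :: "'a set" and \<F> \<G> :: "'a set set" and \<mu> :: "'a set \<Rightarrow> ennreal"
  assumes "sigma_algebra \<Omega> \<F>"
    and "fa_measure \<F> \<mu>"
    and "\<G> \<subseteq> \<F>"
  shows
    "((\<exists>X. ess_greatest \<F> \<mu> \<G> X) \<longleftrightarrow>
      (\<exists>Y \<mu>1 \<mu>2. class_decomposition \<Omega> \<F> \<mu> \<G> Y \<mu>1 \<mu>2))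
     \<and> (\<forall>X X'. ess_greatest \<F> \<mu> \<G> X \<longrightarrow> ess_greatest \<F> \<mu> \<G> X' \<longrightarrow> eq_upto_null \<F> \<mu> X X')
     \<and> (\<forall>Y \<mu>1 \<mu>2 Y' \<mu>1' \<mu>2'.
          class_decomposition \<Omega> \<F> \<mu> \<G> Y \<mu>1 \<mu>2 \<longrightarrow>
          class_decomposition \<Omega> \<F> \<mu> \<G> Y' \<mu>1' \<mu>2' \<longrightarrow>
          eq_upto_null \<F> \<mu> Y Y' \<and> (\<forall>A\<in>\<F>. \<mu>1 A = \<mu>1' A) \<and> (\<forall>A\<in>\<F>. \<mu>2 A = \<mu>2' A))
     \<and> (\<forall>X Y \<mu>1 \<mu>2.
          ess_greatest \<F> \<mu> \<G> X \<longrightarrow>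
          class_decomposition \<Omega> \<F> \<mu> \<G> Y \<mu>1 \<mu>2 \<longrightarrow>
          eq_upto_null \<F> \<mu> X Y \<and>
          (\<forall>A\<in>\<F>. \<mu>1 A = \<mu> (X \<inter> A)) \<and> (\<forall>A\<in>\<F>. \<mu>2 A = \<mu> ((\<Omega> - X) \<inter> A)))
     \<and> (sigma_finite_ca_measure \<Omega> \<F> \<mu> \<longrightarrow>
        \<G> \<noteq> {} \<longrightarrow>
        (\<forall>A :: nat \<Rightarrow> 'a set. range A \<subseteq> \<G> \<longrightarrow> (\<Union>n. A n) \<in> \<G>) \<longrightarrow>
        (\<exists>X. ess_greatest \<F> \<mu> \<G> X))"
  (is "?ab \<and> ?X \<and> ?Y \<and> ?XY \<and> ?ex")
proof (intro conjI)
  note greatest = class_decomposition_imp_ess_greatest[OF assms(1,3)]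
    and parts = class_decomposition_parts[OF assms(1,3)]
    and unique = ess_greatest_unique[OF assms(3)]
    and restrict = eq_upto_null_restrict[OF assms(1,2)]
  show ?ab
    using ess_greatest_imp_class_decomposition[OF assms] greatest by blast
  show ?X
    using unique by blast
  show ?XY
  proof (intro allI impI)
    fix X Y \<mu>1 \<mu>2
    assume X: "ess_greatest \<F> \<mu> \<G> X" and dec: "class_decomposition \<Omega> \<F> \<mu> \<G> Y \<mu>1 \<mu>2"
    note eq = unique[OF X greatest[OF dec]]
    show "eq_upto_null \<F> \<mu> X Y \<and>
        (\<forall>A\<in>\<F>. \<mu>1 A = \<mu> (X \<inter> A)) \<and> (\<forall>A\<in>\<F>. \<mu>2 A = \<mu> ((\<Omega> - X) \<inter> A))"
      \<comment> \<open>\<open>parts\<close> yields the restrictions to \<open>Y\<close> and its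
        complement, and \<open>restrict\<close> then exchanges \<open>Y\<close> for
        \<open>X\<close>.\<close>
      using eq parts[OF dec] restrict[OF eq] by simp
  qed
  \<comment> \<open>By \<open>greatest\<close>, \<open>Y\<close> can play the role of
    \<open>X\<close> in \<open>?XY\<close> against both decompositions, so their parts are the same
    two restrictions of \<open>\<mu>\<close>.\<close>
  then show ?Y
    using greatest by (metis (no_types, lifting))
  show ?ex
    using sigma_finite_ca_ess_greatest[OF _ assms(3)] by blast
qed

end
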